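(* Let $J,I$ be finite sets and let $A:C(I)\to C(J)$ be the operator defined by a matrix $a:J\times I\to\mathbf{R}_+^*$, i.e. $(Af)(j)=\sum_{i\in I}a(j,i)f(i)$. Let $u\in C(I)$ be a strictly positive vector and let $B:C(I)\to C(J)$ be the Markovian operator defined by the matrix $$b(j,i)=(Au(j))^{-1}a(j,i)u(i).$$ Then, for all $f\in C(I)$, $$\mathrm{var}(Bf)\le\Big(1-\frac{a_{min}}{a_{max}}\Big)\,\mathrm{var}(f),$$ where $a_{min}$ and $a_{max}$ are the smallest and the largest entries of $a$.
   Context: $\mathbf{R}_+^*=(0,\infty)$. For a finite (nonempty) set $I$, $C(I)$ is the space of real-valued functions on $I$, and $\mathrm{var}(f)=\max_If-\min_If$. An operator is Markovian if it is positive ($f\ge0\Rightarrow Bf\ge0$) and sends the constant function $1$ to the constant function $1$. *)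

theory Defs
  imports "HOL-Analysis.Analysis"
begin

text \<open>The space \<open>C(I)\<close> of real functions on a finite nonempty set \<open>I\<close> is \<open>real ^ 'i\<close>, and the
  operator \<open>C(I) \<rightarrow> C(J)\<close> of a matrix \<open>a :: real ^ 'i ^ 'j\<close>, with entry \<open>a(j,i) = a $ j $ i\<close>,
  is \<open>\<lambda>f. a *v f\<close>.\<close>

definition var :: "real ^ 'i \<Rightarrow> real" where
  "var f = Max (range (\<lambda>i. f $ i)) - Min (range (\<lambda>i. f $ i))"

text \<open>The numeral \<open>1\<close> of type \<open>real ^ 'i\<close> is the constant function \<open>1\<close>.\<close>

definition markovian :: "(real ^ 'i \<Rightarrow> real ^ 'j) \<Rightarrow> bool" where
  "markovian B \<longleftrightarrow> linear B \<and> (\<forall>f. (\<forall>i. 0 \<le> f $ i) \<longrightarrow> (\<forall>j. 0 \<le> B f $ j)) \<and> B 1 = 1"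

definition normalized_matrix :: "real ^ 'i ^ 'j \<Rightarrow> real ^ 'i \<Rightarrow> real ^ 'i ^ 'j" where
  "normalized_matrix a u = (\<chi> j i. inverse ((a *v u) $ j) * a $ j $ i * u $ i)"

definition min_entry :: "real ^ 'i ^ 'j \<Rightarrow> real" where
  "min_entry a = Min (range (\<lambda>(j, i). a $ j $ i))"

definition max_entry :: "real ^ 'i ^ 'j \<Rightarrow> real" where
  "max_entry a = Max (range (\<lambda>(j, i). a $ j $ i))"

end

theory Submission
  imports Defs
begin

text \<open>
  With \<open>p = u / (\<Sum>i. u(i))\<close> and \<open>\<theta> = a\<^sub>m\<^sub>i\<^sub>n / a\<^sub>m\<^sub>a\<^sub>x\<close>, every row of \<open>b\<close>
  dominates \<open>\<theta> p\<close> (Doeblin's minorization). The part \<open>\<theta> p\<close>, common to all rows, contributes the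
  same constant to every \<open>Bf(j)\<close>, and what remains is a positive operator whose rows have
  mass \<open>1 - \<theta>\<close>.
\<close>

lemma markovian_matrix_vector_mul:
  fixes P :: "real ^ 'i ^ 'j"
  assumes nonneg: "\<And>j i. 0 \<le> P $ j $ i" and row_sum: "\<And>j. (\<Sum>i\<in>UNIV. P $ j $ i) = 1"
  shows "markovian (\<lambda>f. P *v f)"
  unfolding markovian_def
proof (intro conjI allI impI)
  show "linear (\<lambda>f. P *v f)"
    by (rule matrix_vector_mul_linear)
  show "0 \<le> (P *v f) $ j" if "\<forall>i. 0 \<le> f $ i" for f j
    using that nonneg by (simp add: matrix_vector_mult_def sum_nonneg)
  show "P *v 1 = 1"
    by (simp add: vec_eq_iff matrix_vector_mult_def row_sum)
qed

lemma var_leI: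
  fixes g :: "real ^ 'j"
  assumes "\<And>j. l \<le> g $ j" and "\<And>j. g $ j \<le> h"
  shows "var g \<le> h - l"
proof -
  have "Max (range (\<lambda>j. g $ j)) \<le> h" and "l \<le> Min (range (\<lambda>j. g $ j))"
    using assms by auto
  then show ?thesis
    unfolding var_def by linarith
qed

text \<open>All values of \<open>P *v f\<close> lie in one interval: the shared part fixes its
  position, and the residual weights, nonnegative by \<open>minor\<close> and of mass
  \<open>1 - \<theta>\<close> in each row, give it length
  \<open>(1 - \<theta>) * var f\<close>.\<close>

lemma var_contraction_of_minorization:
  fixes P :: "real ^ 'i ^ 'j" and p :: "'i \<Rightarrow> real"
  assumes row_sum: "\<And>j. (\<Sum>i\<in>UNIV. P $ j $ i) = 1" and p_sum: "(\<Sum>i\<in>UNIV. p i) = 1"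
    and minor: "\<And>j i. \<theta> * p i \<le> P $ j $ i"
  shows "var (P *v f) \<le> (1 - \<theta>) * var f"
proof -
  let ?m = "Min (range (\<lambda>i. f $ i))" and ?M = "Max (range (\<lambda>i. f $ i))"
  define c where "c = (\<Sum>i\<in>UNIV. \<theta> * p i * f $ i)"
  have split: "(P *v f) $ j = c + (\<Sum>i\<in>UNIV. (P $ j $ i - \<theta> * p i) * f $ i)" for j
    by (simp add: c_def matrix_vector_mult_def left_diff_distrib sum_subtractf)
  \<comment> \<open>Read backwards with \<open>x\<close> the minimum or maximum of \<open>f\<close>,
    this turns each bound below into a sum with the same residual weights, so that the comparison is
    term by term.\<close>
  have mass: "(\<Sum>i\<in>UNIV. (P $ j $ i - \<theta> * p i) * x) = (1 - \<theta>) * x" for j x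
    by (simp add: sum_distrib_right [symmetric] sum_subtractf sum_distrib_left [symmetric]
        row_sum p_sum)
  have lower: "c + (1 - \<theta>) * ?m \<le> (P *v f) $ j" for j
    unfolding split mass [of j, symmetric]
    by (intro add_left_mono sum_mono mult_left_mono) (simp_all add: minor)
  have upper: "(P *v f) $ j \<le> c + (1 - \<theta>) * ?M" for j
    unfolding split mass [of j, symmetric]
    by (intro add_left_mono sum_mono mult_left_mono) (simp_all add: minor)
  show ?thesis
    using var_leI [OF lower upper] by (simp add: var_def right_diff_distrib)
qed

lemma min_entry_le: "min_entry a \<le> a $ j $ i"
  unfolding min_entry_def by (rule Min_le) (auto intro: range_eqI [where x = "(j, i)"])

lemma le_max_entry: "a $ j $ i \<le> max_entry a"
  unfolding max_entry_def by (rule Max_ge) (auto intro: range_eqI [where x = "(j, i)"])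

theorem lemmaA6:
  fixes a :: "real ^ 'i ^ 'j" and u :: "real ^ 'i"
  assumes "\<And>j i. 0 < a $ j $ i"
    and "\<And>i. 0 < u $ i"
  defines "B \<equiv> (\<lambda>f. normalized_matrix a u *v f)"
  shows "markovian B \<and> (\<forall>f. var (B f) \<le> (1 - min_entry a / max_entry a) * var f)"
proof -
  define S where "S = (\<Sum>i\<in>UNIV. u $ i)"
  have S_pos: "0 < S"
    unfolding S_def by (rule sum_pos) (simp_all add: assms(2))
  have Au: "(a *v u) $ j = (\<Sum>i\<in>UNIV. a $ j $ i * u $ i)" for j
    by (simp add: matrix_vector_mult_def)
  have Au_pos: "0 < (a *v u) $ j" for j
    unfolding Au by (rule sum_pos) (simp_all add: assms(1,2))
  \<comment> \<open>The largest entry enters only here; the bound is the same for all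
    \<open>j\<close>, as a minorization common to all rows requires.\<close>
  have Au_le: "(a *v u) $ j \<le> max_entry a * S" for j
    unfolding Au S_def sum_distrib_left
    by (intro sum_mono mult_right_mono le_max_entry less_imp_le assms(2))
  have entry: "normalized_matrix a u $ j $ i = a $ j $ i * u $ i / (a *v u) $ j" for j i
    by (simp add: normalized_matrix_def field_simps)
  have row_sum: "(\<Sum>i\<in>UNIV. normalized_matrix a u $ j $ i) = 1" for j
    using Au_pos [of j] by (simp add: entry sum_divide_distrib [symmetric] Au [symmetric])
  have p_sum: "(\<Sum>i\<in>UNIV. u $ i / S) = 1"
    using S_pos by (simp add: sum_divide_distrib [symmetric] S_def [symmetric])
  have minor: "min_entry a / max_entry a * (u $ i / S) \<le> normalized_matrix a u $ j $ i" for j i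
  proof -
    \<comment> \<open>The left side is \<open>\<theta> p(i)\<close> as a single fraction: compared
      with the entry of \<open>b\<close>, its numerator is at most as large and its denominator, by
      \<open>Au_le\<close>, at least as large.\<close>
    have "min_entry a * u $ i / (max_entry a * S) \<le> a $ j $ i * u $ i / (a *v u) $ j"
      by (intro frac_le mult_nonneg_nonneg mult_right_mono min_entry_le Au_le Au_pos
          less_imp_le assms(1,2))
    then show ?thesis
      by (simp add: entry)
  qed
  have "markovian B"
    unfolding B_def
    by (rule markovian_matrix_vector_mul [OF _ row_sum])
      (simp add: entry less_imp_le assms(1,2) Au_pos)
  then show ?thesis
    unfolding B_def using var_contraction_of_minorization [OF row_sum p_sum minor] by blast
qed

end
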